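(* Let $H_n$ denote the number of binary words of length $n$ whose only square subwords are among $00$, $11$ and $0101$. Then $H_n=\Omega(1.0006^n)$ and $H_n=O(1.135^n)$.
   Context: A square is a nonempty word of the form $xx$, considered as a contiguous subword. *)

theory Defs
  imports Complex_Main "HOL-Library.Sublist" "HOL-Library.Landau_Symbols"
begin

definition is_square :: "'a list \<Rightarrow> bool" where
  "is_square s \<longleftrightarrow> (\<exists>x. x \<noteq> [] \<and> s = x @ x)"

definition binary_word :: "nat list \<Rightarrow> bool" where
  "binary_word w \<longleftrightarrow> set w \<subseteq> {0, 1}"

text \<open>The library predicate \<^const>\<open>sublist\<close> is the contiguous subword (factor) relation,
  not the scattered one.\<close>

definition H :: "nat \<Rightarrow> nat" where
  "H n = card {w. binary_word w \<and> length w = n \<and>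
     (\<forall>s. sublist s w \<and> is_square s \<longrightarrow> s \<in> {[0,0], [1,1], [0,1,0,1]})}"

end

theory Submission
  imports Defs
begin

text \<open>
  Upper bound: attach a weight to every word that is a prefix of a minimal forbidden square of period at
  most 8. If, for each such context, the weights of the contexts reached by appending one letter add up
  to at most 1.135 times its own weight, then the number of admissible extensions of length n is at most
  the weight times \<open>1.135 ^ n\<close>.

  Lower bound: Leech's 13-uniform morphism yields arbitrarily long square-free ternary words in which
  every block contains the letter 0. A 67-uniform substitution with two images for the letter 0 and one
  for each of 1 and 2 maps square-free ternary words to binary words whose only squares are the three
  allowed ones. Hence \<open>H (871 * n) \<ge> 2 ^ n\<close>, where \<open>871 = 13 * 67\<close>, and
  \<open>2 powr (1 / 871) > 1.0006\<close>. For both substitutions a sufficiently long window determines its position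
  modulo the block length, so a long square has a period divisible by the block length and comes from a
  square in the preimage, while a short square lies in two consecutive blocks.
\<close>

section \<open>Upper bound\<close>

definition allowed_squares :: "nat list set" where
  "allowed_squares = {[0,0], [1,1], [0,1,0,1]}"

definition good :: "nat list \<Rightarrow> bool" where
  "good w \<longleftrightarrow> binary_word w \<and> (\<forall>s. sublist s w \<and> is_square s \<longrightarrow> s \<in> allowed_squares)"

lemma H_eq_card_good: "H n = card {w. good w \<and> length w = n}"
  unfolding H_def good_def allowed_squares_def by (rule arg_cong[where f = card]) auto

lemma good_sublist: "good w \<Longrightarrow> sublist v w \<Longrightarrow> good v"
  unfolding good_def binary_word_def by (meson set_mono_sublist sublist_order.order.trans subset_trans)

definition extensions :: "nat list \<Rightarrow> nat \<Rightarrow> nat list set" where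
  "extensions u n = {x. length x = n \<and> good (u @ x)}"

lemma finite_extensions: "finite (extensions u n)"
proof (rule finite_subset)
  show "extensions u n \<subseteq> {x. set x \<subseteq> {0, 1} \<and> length x = n}"
    by (auto simp: extensions_def good_def binary_word_def)
  show "finite {x. set x \<subseteq> {0, 1 :: nat} \<and> length x = n}"
    by (rule finite_lists_length_eq) simp
qed

text \<open>A factor of a good word is good, so forgetting a prefix \<open>p\<close> can only add
  extensions. This lets the counting remember only a bounded context.\<close>

lemma extensions_append_subset: "extensions (p @ u) n \<subseteq> extensions u n"
  by (auto simp: extensions_def elim!: good_sublist)

lemma extensions_Suc:
  "extensions u (Suc n) = (#) 0 ` extensions (u @ [0]) n \<union> (#) 1 ` extensions (u @ [1]) n"
    (is "_ = ?R")
proof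
  show "extensions u (Suc n) \<subseteq> ?R"
  proof
    fix x assume x: "x \<in> extensions u (Suc n)"
    then obtain c y where [simp]: "x = c # y" and "length y = n" "good (u @ c # y)"
      by (auto simp: extensions_def length_Suc_conv)
    moreover from this have "c = 0 \<or> c = 1" by (auto simp: good_def binary_word_def)
    ultimately show "x \<in> ?R" by (auto simp: extensions_def)
  qed
qed (auto simp: extensions_def)

lemma card_extensions_Suc_le:
  "card (extensions u (Suc n)) \<le> card (extensions (u @ [0]) n) + card (extensions (u @ [1]) n)"
  unfolding extensions_Suc
  by (rule order.trans[OF card_Un_le]) (intro add_mono card_image_le finite_extensions)

lemma H_eq_card_extensions: "H n = card (extensions [] n)"
  unfolding H_eq_card_good extensions_def by (rule arg_cong[where f = card]) auto

text \<open>For the lower bound: it leads from lengths divisible by 871 to all lengths.\<close>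

lemma H_Suc_le: "H (Suc n) \<le> 2 * H n"
proof -
  have "card (extensions [c] n) \<le> card (extensions [] n)" for c
    using extensions_append_subset[of "[c]" "[]" n] by (intro card_mono finite_extensions) simp
  from this[of 0] this[of 1] show ?thesis
    using card_extensions_Suc_le[of "[]" n] unfolding H_eq_card_extensions by simp
qed

text \<open>A node of a context tree stands for the word that is read off the path from that node up to the
  root: descending prepends a letter to the context. A context of weight \<open>0\<close> is itself a forbidden
  square. The function \<open>weight\<close> takes the reversed word and stops at its longest known suffix.\<close>

datatype context_tree = Tip | Ctx int context_tree context_tree

fun weight :: "context_tree \<Rightarrow> nat list \<Rightarrow> int" where
  "weight Tip x = 0"
| "weight (Ctx v l r) [] = v"
| "weight (Ctx v l r) (c # x) =
    (case (if c = 0 then l else r) of Tip \<Rightarrow> v | Ctx v' l' r' \<Rightarrow> weight (Ctx v' l' r') x)"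

fun weight_at :: "context_tree \<Rightarrow> nat list \<Rightarrow> int option" where
  "weight_at Tip x = None"
| "weight_at (Ctx v l r) [] = Some v"
| "weight_at (Ctx v l r) (c # x) = weight_at (if c = 0 then l else r) x"

text \<open>The lookup stops at a node \<open>y\<close> on the path of \<open>x\<close>. Read
  backwards, \<open>y\<close> is a suffix of the word, so the weight used for a word is that of one
  of its suffixes.\<close>

lemma weight_at_prefix:
  "t \<noteq> Tip \<Longrightarrow> \<exists>y z. x = y @ z \<and> weight_at t y = Some (weight t x)"
proof (induction t x rule: weight.induct)
  case (3 v l r c x)
  show ?case
  proof (cases "if c = 0 then l else r")
    case Tip
    then show ?thesis by (intro exI[of _ "[]"] exI[of _ "c # x"]) simp
  next
    case (Ctx v' l' r')
    with 3 obtain y z where "x = y @ z" "weight_at (Ctx v' l' r') y = Some (weight (Ctx v' l' r') x)"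
      by blast
    with Ctx show ?thesis by (intro exI[of _ "c # y"] exI[of _ z]) simp
  qed
qed auto

section \<open>Certifying exponential growth by weighted contexts\<close>

definition bad_square :: "nat list \<Rightarrow> bool" where
  "bad_square u \<longleftrightarrow> u \<noteq> [] \<and> take (length u div 2) u = drop (length u div 2) u \<and>
     u \<notin> allowed_squares"

lemma extensions_bad_square:
  assumes "bad_square u"
  shows "extensions u n = {}"
proof -
  \<comment> \<open>Odd length is excluded, because the two parts would then have different
    lengths.\<close>
  have "u = take (length u div 2) u @ take (length u div 2) u"
    using assms append_take_drop_id[of "length u div 2" u] by (simp add: bad_square_def)
  then have "is_square u" using assms unfolding is_square_def bad_square_def
    by (metis append_Nil)
  moreover have "u \<notin> allowed_squares" using assms by (simp add: bad_square_def)
  ultimately show ?thesis by (auto simp: extensions_def good_def intro: sublist_appendI)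
qed

text \<open>\<open>f\<close> expects reversed words, so \<open>c # rev u\<close> is \<open>u\<close>
  with \<open>c\<close> appended. The ratio 1.135 is written as 1135 over 1000 to keep the check in
  integers.\<close>

definition context_ok :: "(nat list \<Rightarrow> int) \<Rightarrow> nat list \<Rightarrow> int \<Rightarrow> bool" where
  "context_ok f u v \<longleftrightarrow>
     (if v = 0 then bad_square u else 0 < v \<and> 1000 * (f (0 # rev u) + f (1 # rev u)) \<le> 1135 * v)"

text \<open>The lookup \<open>f\<close> is a parameter because the successor of a context may lie
  anywhere in the whole tree, while the recursion sees only a subtree.\<close>

fun contexts_ok :: "(nat list \<Rightarrow> int) \<Rightarrow> nat list \<Rightarrow> context_tree \<Rightarrow> bool" where
  "contexts_ok f u Tip = True"
| "contexts_ok f u (Ctx v l r) \<longleftrightarrow>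
     context_ok f u v \<and> contexts_ok f (0 # u) l \<and> contexts_ok f (1 # u) r"

lemma contexts_okD:
  assumes "contexts_ok f u t" "weight_at t x = Some v" "set x \<subseteq> {0, 1}"
  shows "context_ok f (rev x @ u) v"
  using assms by (induction t x arbitrary: u rule: weight_at.induct) (auto split: if_splits)

text \<open>Induction on the number of letters still to be appended. A context of weight 0 has no
  extensions; otherwise each successor is cut down to a known suffix, and the weight inequality
  yields a factor 1.135 per letter.\<close>

lemma card_extensions_le_weight:
  assumes ok: "contexts_ok (weight t) [] t" and "t \<noteq> Tip"
  shows "weight_at t x = Some v \<Longrightarrow> set x \<subseteq> {0, 1} \<Longrightarrow>
    real (card (extensions (rev x) n)) \<le> of_int v * 1.135 ^ n"
proof (induction n arbitrary: x v)
  case 0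
  have "card (extensions (rev x) 0) \<le> card {[] :: nat list}"
    by (rule card_mono) (auto simp: extensions_def)
  moreover have "extensions (rev x) 0 = {}" if "v = 0"
    using contexts_okD[OF ok "0.prems"] that by (simp add: context_ok_def extensions_bad_square)
  \<comment> \<open>A positive integer weight is at least 1, which accounts for the empty
    extension.\<close>
  moreover have "1 \<le> v" if "v \<noteq> 0"
    using contexts_okD[OF ok "0.prems"] that by (simp add: context_ok_def)
  ultimately show ?case by (cases "v = 0") auto
next
  case (Suc n)
  show ?case
  proof (cases "v = 0")
    case True
    then show ?thesis
      using contexts_okD[OF ok Suc.prems] by (simp add: context_ok_def extensions_bad_square)
  next
    case False
    have le: "real (card (extensions (rev x @ [c]) n)) \<le> of_int (weight t (c # x)) * 1.135 ^ n"
      if c: "c \<in> {0, 1}" for c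
    proof -
      obtain y z where yz: "c # x = y @ z" "weight_at t y = Some (weight t (c # x))"
        using weight_at_prefix[OF \<open>t \<noteq> Tip\<close>] by blast
      then have "set (y @ z) \<subseteq> {0, 1}" using Suc.prems(2) c by (metis insert_subset list.simps(15))
      then have "set y \<subseteq> {0, 1}" by simp
      have "rev x @ [c] = rev z @ rev y" using arg_cong[OF yz(1), of rev] by simp
      then have "card (extensions (rev x @ [c]) n) \<le> card (extensions (rev y) n)"
        by (metis card_mono extensions_append_subset finite_extensions)
      also have "real (card (extensions (rev y) n)) \<le> of_int (weight t (c # x)) * 1.135 ^ n"
        by (rule Suc.IH) fact+
      finally show ?thesis by simp
    qed
    have "1000 * (weight t (0 # x) + weight t (1 # x)) \<le> 1135 * v"
      using contexts_okD[OF ok Suc.prems] False by (simp add: context_ok_def)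
    then have "real_of_int (1000 * (weight t (0 # x) + weight t (1 # x))) \<le> of_int (1135 * v)"
      by (simp only: of_int_le_iff)
    then have w: "real_of_int (weight t (0 # x)) + of_int (weight t (1 # x)) \<le> 1.135 * of_int v"
      by simp
    have "real (card (extensions (rev x) (Suc n))) \<le>
        real (card (extensions (rev x @ [0]) n)) + real (card (extensions (rev x @ [1]) n))"
      using card_extensions_Suc_le[of "rev x" n] by simp
    also have "\<dots> \<le> (of_int (weight t (0 # x)) + of_int (weight t (1 # x))) * 1.135 ^ n"
      using le[of 0] le[of 1] by (simp add: distrib_right)
    also have "\<dots> \<le> (1.135 * of_int v) * 1.135 ^ n"
      using w by (intro mult_right_mono) simp_all
    finally show ?thesis by (simp add: algebra_simps)
  qed
qed

text \<open>The contexts are the prefixes of the minimal forbidden squares of period at most \<open>8\<close>. With \<open>A\<close>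
  the transition matrix of the automaton that avoids these squares (its spectral radius is about
  \<open>1.1347\<close>), the weights are the rounded solution \<open>v\<close> of \<open>1.135 v - A v = (3, \<dots>, 3)\<close>.\<close>

definition square_contexts :: context_tree where
  "square_contexts =
    Ctx 361529 (Ctx 228170 (Ctx 125152 (Ctx 54375 (Ctx 0 Tip Tip) (Ctx 40713 (Ctx 40711 (Ctx
    24085 (Ctx 3 Tip (Ctx 0 Tip Tip)) Tip) Tip) (Ctx 34300 (Ctx 22290 (Ctx 22286 (Ctx 12662 Tip
    (Ctx 3 Tip (Ctx 0 Tip Tip))) Tip) (Ctx 22289 (Ctx 17521 (Ctx 17519 (Ctx 9639 Tip (Ctx 9637
    Tip (Ctx 9633 (Ctx 3 Tip (Ctx 0 Tip Tip)) Tip))) Tip) Tip) Tip)) (Ctx 34298 (Ctx 21757 (Ctx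
    21753 (Ctx 21751 Tip (Ctx 13704 Tip (Ctx 3 Tip (Ctx 0 Tip Tip)))) Tip) (Ctx 21756 (Ctx 16809
    (Ctx 16806 (Ctx 16805 Tip (Ctx 8064 Tip (Ctx 8062 Tip (Ctx 8058 (Ctx 3 Tip (Ctx 0 Tip Tip))
    Tip)))) Tip) Tip) Tip)) Tip)))) (Ctx 85616 (Ctx 67507 (Ctx 21223 (Ctx 5 Tip (Ctx 3 (Ctx 0
    Tip Tip) Tip)) (Ctx 0 Tip Tip)) Tip) (Ctx 58519 (Ctx 43169 (Ctx 32981 (Ctx 24501 Tip (Ctx
    13348 Tip (Ctx 13345 (Ctx 0 Tip Tip) Tip))) (Ctx 19638 Tip (Ctx 0 Tip Tip))) (Ctx 35946 (Ctx
    31744 (Ctx 25629 (Ctx 18686 Tip (Ctx 18684 Tip (Ctx 18681 (Ctx 10196 Tip (Ctx 10194 (Ctx 0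
    Tip Tip) Tip)) Tip))) (Ctx 25627 Tip (Ctx 25625 (Ctx 15438 Tip (Ctx 0 Tip Tip)) Tip))) Tip)
    Tip)) (Ctx 48339 (Ctx 37282 (Ctx 37277 (Ctx 37275 Tip (Ctx 30185 Tip (Ctx 18113 Tip (Ctx
    18111 (Ctx 0 Tip Tip) Tip)))) (Ctx 37271 Tip (Ctx 19168 Tip (Ctx 0 Tip Tip)))) (Ctx 31178
    (Ctx 26816 (Ctx 26813 (Ctx 26812 Tip (Ctx 19110 Tip (Ctx 19109 Tip (Ctx 19105 (Ctx 12008 Tip
    (Ctx 12006 (Ctx 0 Tip Tip) Tip)) Tip)))) (Ctx 14823 Tip (Ctx 14822 Tip (Ctx 14820 (Ctx 14810
    Tip (Ctx 0 Tip Tip)) Tip)))) Tip) Tip)) Tip)))) (Ctx 113659 (Ctx 92857 (Ctx 48391 (Ctx 25512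
    Tip (Ctx 21421 (Ctx 21418 (Ctx 0 Tip Tip) Tip) (Ctx 21418 (Ctx 16305 Tip (Ctx 16303 (Ctx
    10161 (Ctx 10159 (Ctx 7 Tip (Ctx 5 Tip (Ctx 0 Tip Tip))) Tip) Tip) Tip)) (Ctx 21416 (Ctx
    17648 Tip (Ctx 17647 (Ctx 11273 (Ctx 11270 (Ctx 11268 Tip (Ctx 7 Tip (Ctx 5 Tip (Ctx 0 Tip
    Tip)))) Tip) Tip) Tip)) Tip)))) (Ctx 23326 (Ctx 0 Tip Tip) (Ctx 23324 (Ctx 17185 Tip (Ctx
    7883 (Ctx 7881 (Ctx 5 Tip (Ctx 3 Tip (Ctx 0 Tip Tip))) Tip) Tip)) (Ctx 23323 (Ctx 23318 Tip
    (Ctx 15455 (Ctx 15452 (Ctx 15450 Tip (Ctx 5 Tip (Ctx 3 Tip (Ctx 0 Tip Tip)))) Tip) Tip))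
    Tip)))) (Ctx 0 Tip Tip)) (Ctx 68122 (Ctx 38039 (Ctx 29063 (Ctx 21592 Tip (Ctx 11765 Tip (Ctx
    11763 (Ctx 5 (Ctx 0 Tip Tip) Tip) Tip))) (Ctx 17307 Tip (Ctx 5 (Ctx 0 Tip Tip) Tip))) (Ctx
    31674 (Ctx 27971 (Ctx 22583 (Ctx 16466 Tip (Ctx 16465 Tip (Ctx 16462 (Ctx 8986 Tip (Ctx 8984
    (Ctx 3 (Ctx 0 Tip Tip) Tip) Tip)) Tip))) (Ctx 22582 Tip (Ctx 22580 (Ctx 13604 Tip (Ctx 3
    (Ctx 0 Tip Tip) Tip)) Tip))) Tip) (Ctx 0 Tip Tip))) (Ctx 42599 (Ctx 32855 (Ctx 32850 (Ctx
    32849 Tip (Ctx 26602 Tip (Ctx 15966 Tip (Ctx 15964 (Ctx 7 (Ctx 0 Tip Tip) Tip) Tip)))) (Ctx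
    32845 Tip (Ctx 16896 Tip (Ctx 7 (Ctx 0 Tip Tip) Tip)))) (Ctx 27475 (Ctx 23632 (Ctx 23629
    (Ctx 23628 Tip (Ctx 16842 Tip (Ctx 16841 Tip (Ctx 16838 (Ctx 10585 Tip (Ctx 10583 (Ctx 5
    (Ctx 0 Tip Tip) Tip) Tip)) Tip)))) (Ctx 13065 Tip (Ctx 13064 Tip (Ctx 13062 (Ctx 13053 Tip
    (Ctx 5 (Ctx 0 Tip Tip) Tip)) Tip)))) Tip) (Ctx 27472 Tip (Ctx 0 Tip Tip)))) Tip)))) (Ctx
    182162 (Ctx 133818 (Ctx 87670 (Ctx 61712 Tip (Ctx 46206 (Ctx 46204 (Ctx 27334 (Ctx 0 Tip
    Tip) Tip) Tip) (Ctx 38928 (Ctx 25296 (Ctx 25292 (Ctx 14368 Tip (Ctx 0 Tip Tip)) Tip) (Ctx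
    25295 (Ctx 19883 (Ctx 19881 (Ctx 10937 Tip (Ctx 10935 Tip (Ctx 10931 (Ctx 0 Tip Tip) Tip)))
    Tip) Tip) Tip)) (Ctx 38925 (Ctx 24692 (Ctx 24687 (Ctx 24685 Tip (Ctx 15551 Tip (Ctx 0 Tip
    Tip))) Tip) (Ctx 24691 (Ctx 19075 (Ctx 19072 (Ctx 19071 Tip (Ctx 9149 Tip (Ctx 9147 Tip (Ctx
    9143 (Ctx 0 Tip Tip) Tip)))) Tip) Tip) Tip)) Tip)))) (Ctx 56458 (Ctx 35906 (Ctx 0 Tip Tip)
    Tip) (Ctx 32116 (Ctx 26704 (Ctx 15144 Tip (Ctx 0 Tip Tip)) (Ctx 18507 (Ctx 18506 (Ctx 11567
    Tip (Ctx 11565 Tip (Ctx 11562 (Ctx 0 Tip Tip) Tip))) Tip) Tip)) (Ctx 20564 (Ctx 20555 (Ctx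
    20553 Tip (Ctx 20547 Tip (Ctx 0 Tip Tip))) (Ctx 13628 (Ctx 13625 (Ctx 13623 Tip (Ctx 15 Tip
    (Ctx 13 Tip (Ctx 11 (Ctx 0 Tip Tip) Tip)))) Tip) Tip)) Tip)))) (Ctx 43385 (Ctx 37882 (Ctx
    33698 (Ctx 28949 Tip (Ctx 24307 Tip (Ctx 24303 (Ctx 18500 Tip (Ctx 18499 (Ctx 11527 (Ctx
    11525 (Ctx 3 Tip (Ctx 0 Tip Tip)) Tip) Tip) Tip)) (Ctx 24301 (Ctx 20025 Tip (Ctx 20023 (Ctx
    12789 (Ctx 12786 (Ctx 12783 Tip (Ctx 3 Tip (Ctx 0 Tip Tip))) Tip) Tip) Tip)) Tip)))) (Ctx
    26472 Tip (Ctx 26470 (Ctx 19502 Tip (Ctx 8944 (Ctx 8942 (Ctx 3 Tip (Ctx 0 Tip Tip)) Tip)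
    Tip)) (Ctx 26468 (Ctx 26463 Tip (Ctx 17538 (Ctx 17535 (Ctx 17533 Tip (Ctx 3 Tip (Ctx 0 Tip
    Tip))) Tip) Tip)) Tip)))) Tip) (Ctx 18796 (Ctx 3 Tip (Ctx 0 Tip Tip)) (Ctx 7 (Ctx 5 Tip (Ctx
    3 Tip (Ctx 0 Tip Tip))) Tip)))) (Ctx 93092 (Ctx 59024 (Ctx 51111 (Ctx 44528 Tip (Ctx 31021
    Tip (Ctx 22763 (Ctx 12403 (Ctx 12399 (Ctx 0 Tip Tip) Tip) Tip) (Ctx 22761 (Ctx 10374 (Ctx
    10369 (Ctx 10366 Tip (Ctx 0 Tip Tip)) Tip) Tip) Tip)))) (Ctx 40750 Tip (Ctx 13125 (Ctx 13120
    (Ctx 0 Tip Tip) Tip) (Ctx 15 (Ctx 9 (Ctx 7 Tip (Ctx 0 Tip Tip)) Tip) Tip)))) (Ctx 49239 (Ctx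
    42993 (Ctx 38244 (Ctx 32854 Tip (Ctx 27585 Tip (Ctx 27581 (Ctx 20995 Tip (Ctx 20993 (Ctx
    13080 (Ctx 13078 (Ctx 0 Tip Tip) Tip) Tip) Tip)) (Ctx 27579 (Ctx 22725 Tip (Ctx 22723 (Ctx
    14512 (Ctx 14509 (Ctx 14506 Tip (Ctx 0 Tip Tip)) Tip) Tip) Tip)) Tip)))) (Ctx 30043 Tip (Ctx
    30040 (Ctx 22132 Tip (Ctx 10148 (Ctx 10146 (Ctx 0 Tip Tip) Tip) Tip)) (Ctx 30039 (Ctx 30032
    Tip (Ctx 19903 (Ctx 19899 (Ctx 19897 Tip (Ctx 0 Tip Tip)) Tip) Tip)) Tip)))) Tip) (Ctx 21331
    (Ctx 0 Tip Tip) (Ctx 5 (Ctx 3 Tip (Ctx 0 Tip Tip)) Tip)))) (Ctx 37534 (Ctx 28950 (Ctx 28945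
    (Ctx 28944 Tip (Ctx 23441 Tip (Ctx 14070 Tip (Ctx 14068 (Ctx 9 (Ctx 3 (Ctx 0 Tip Tip) Tip)
    Tip) Tip)))) (Ctx 28941 Tip (Ctx 14889 Tip (Ctx 9 (Ctx 3 (Ctx 0 Tip Tip) Tip) Tip)))) (Ctx
    24209 (Ctx 20824 (Ctx 20821 (Ctx 20820 Tip (Ctx 14842 Tip (Ctx 14840 Tip (Ctx 14838 (Ctx
    9328 Tip (Ctx 9326 (Ctx 7 (Ctx 3 (Ctx 0 Tip Tip) Tip) Tip) Tip)) Tip)))) (Ctx 11514 Tip (Ctx
    11513 Tip (Ctx 11511 (Ctx 11503 Tip (Ctx 7 (Ctx 3 (Ctx 0 Tip Tip) Tip) Tip)) Tip)))) Tip)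
    (Ctx 24207 Tip (Ctx 3 (Ctx 0 Tip Tip) Tip)))) (Ctx 0 Tip Tip))))"

text \<open>A separate constant, so that \<open>code_simp\<close> does not carry the unfolded tree along as an argument.\<close>

definition square_weight :: "nat list \<Rightarrow> int" where
  "square_weight x = weight square_contexts x"

lemma contexts_ok_square_contexts: "contexts_ok (weight square_contexts) [] square_contexts"
proof -
  have "contexts_ok square_weight [] square_contexts" by code_simp
  then show ?thesis by (simp add: square_weight_def[abs_def])
qed

text \<open>The constant is the weight 361529 of the root, that is, of the empty context.\<close>

lemma H_upper: "real (H n) \<le> of_int (weight square_contexts []) * 1.135 ^ n"
proof -
  have "weight_at square_contexts [] = Some (weight square_contexts [])" "square_contexts \<noteq> Tip"
    by (simp_all add: square_contexts_def)
  then show ?thesis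
    using card_extensions_le_weight[OF contexts_ok_square_contexts, of "[]"]
    by (simp add: H_eq_card_extensions)
qed

section \<open>Synchronizing uniform substitutions\<close>

definition square_at :: "'a list \<Rightarrow> nat \<Rightarrow> nat \<Rightarrow> bool" where
  "square_at t i p \<longleftrightarrow> 0 < p \<and> i + 2 * p \<le> length t \<and> (\<forall>j<p. t ! (i + j) = t ! (i + p + j))"

lemma square_at_append:
  assumes "x \<noteq> []"
  shows "square_at (ys @ (x @ x) @ zs) (length ys) (length x)"
  using assms by (auto simp: square_at_def nth_append)

lemma square_at_iff_take_drop:
  "square_at t i p \<longleftrightarrow>
     0 < p \<and> i + 2 * p \<le> length t \<and> take p (drop i t) = take p (drop (i + p) t)"
proof -
  have "take p (drop i t) = take p (drop (i + p) t) \<longleftrightarrow> (\<forall>j<p. t ! (i + j) = t ! (i + p + j))"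
    if "i + 2 * p \<le> length t"
    using that by (auto simp: list_eq_iff_nth_eq)
  then show ?thesis by (auto simp: square_at_def)
qed

definition square_free :: "'a list \<Rightarrow> bool" where
  "square_free w \<longleftrightarrow> (\<forall>i p. \<not> square_at w i p)"

text \<open>Equal neighbours form a square of period 1. Hence only blocks of distinct letters stand
  side by side in an image.\<close>

lemma square_free_adjacent:
  assumes "square_free w" "Suc q < length w"
  shows "w ! q \<noteq> w ! Suc q"
proof
  assume "w ! q = w ! Suc q"
  then have "square_at w q 1" using assms(2) by (simp add: square_at_def)
  then show False using assms(1) by (simp add: square_free_def)
qed

text \<open>Several symbols may stand for the same letter, which \<open>\<pi>\<close> recovers; this models a substitution with
  a choice of images. Every window of length \<open>m\<close> reveals its position relative to the block boundaries,
  and blocks of different letters differ on either side of \<open>cut\<close>. Because of \<open>2 * m \<le> k + 3\<close>, squares of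
  period less than \<open>m\<close> fit into two consecutive blocks.\<close>

locale synchronizing_blocks =
  fixes S :: "'a set" and block :: "'a \<Rightarrow> 'b list" and \<pi> :: "'a \<Rightarrow> 'c"
    and k m cut :: nat and offset :: "'b list \<Rightarrow> nat"
  assumes length_block: "a \<in> S \<Longrightarrow> length (block a) = k"
    and window_le: "0 < m" "m \<le> k" "2 * m \<le> k + 3"
    and offset_window: "\<lbrakk>a \<in> S; b \<in> S; \<pi> a \<noteq> \<pi> b; i < k\<rbrakk> \<Longrightarrow>
          offset (take m (drop i (block a @ block b))) = i"
    and take_cut: "\<lbrakk>a \<in> S; b \<in> S; \<pi> a \<noteq> \<pi> b\<rbrakk> \<Longrightarrow> take cut (block a) \<noteq> take cut (block b)"
    and drop_cut: "\<lbrakk>a \<in> S; b \<in> S; \<pi> a \<noteq> \<pi> b\<rbrakk> \<Longrightarrow> drop cut (block a) \<noteq> drop cut (block b)"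
begin

definition expand :: "'a list \<Rightarrow> 'b list" where
  "expand w = concat (map block w)"

lemma expand_Cons: "expand (a # w) = block a @ expand w"
  by (simp add: expand_def)

lemma length_expand: "set w \<subseteq> S \<Longrightarrow> length (expand w) = k * length w"
  by (induction w) (auto simp: expand_def length_block)

lemma drop_expand: "set w \<subseteq> S \<Longrightarrow> q \<le> length w \<Longrightarrow> drop (k * q) (expand w) = expand (drop q w)"
proof (induction w arbitrary: q)
  case (Cons a w)
  then show ?case by (cases q) (auto simp: expand_def length_block)
qed (simp add: expand_def)

lemma nth_expand:
  assumes "set w \<subseteq> S" "q < length w" "r < k"
  shows "expand w ! (k * q + r) = block (w ! q) ! r"
proof -
  have "length (block (w ! q)) = k" using assms by (intro length_block) auto
  moreover have "expand w ! (k * q + r) = drop (k * q) (expand w) ! r"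
    using assms by (intro nth_drop[symmetric]) (simp add: length_expand)
  moreover have "drop (k * q) (expand w) = block (w ! q) @ expand (drop (Suc q) w)"
    using assms drop_expand[of w q] Cons_nth_drop_Suc[of q w, symmetric] by (simp add: expand_def)
  ultimately show ?thesis using assms by (simp add: nth_append)
qed

section \<open>Squares in the image of a word with square-free letters\<close>

context
  fixes w :: "'a list"
  assumes w: "set w \<subseteq> S" "square_free (map \<pi> w)" "2 \<le> length w"
begin

lemma in_S: "q < length w \<Longrightarrow> w ! q \<in> S"
  using w(1) by auto

lemma \<pi>_adjacent: "Suc q < length w \<Longrightarrow> \<pi> (w ! q) \<noteq> \<pi> (w ! Suc q)"
  using square_free_adjacent[OF w(2), of q] by simp

lemma k_pos: "0 < k"
  using window_le by simp

text \<open>Reduces a question about a short factor to a single pair of adjacent blocks, which the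
  locale assumptions control.\<close>

lemma sublist_two_blocks:
  assumes "Suc q < length w" "k * q \<le> i" "i + n \<le> k * (q + 2)"
  shows "take n (drop i (expand w)) = take n (drop (i - k * q) (block (w ! q) @ block (w ! Suc q)))"
proof -
  have len: "length (block (w ! q)) = k" "length (block (w ! Suc q)) = k"
    using assms(1) by (simp_all add: length_block in_S)
  have "drop i (expand w) = drop (i - k * q) (drop (k * q) (expand w))"
    using assms by simp
  also have "drop (k * q) (expand w) = expand (drop q w)"
    using w assms by (intro drop_expand) auto
  also have "drop q w = w ! q # w ! Suc q # drop (Suc (Suc q)) w"
    using assms by (simp add: Cons_nth_drop_Suc)
  also have "expand \<dots> = (block (w ! q) @ block (w ! Suc q)) @ expand (drop (Suc (Suc q)) w)"
    by (simp add: expand_def)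
  finally show ?thesis using assms len by (simp add: algebra_simps)
qed

text \<open>A window of length \<open>m\<close> \<le> \<open>k\<close> meets at most two consecutive
  blocks, so the assumption on pairs applies.\<close>

lemma offset_expand:
  assumes "i + m \<le> length (expand w)"
  shows "offset (take m (drop i (expand w))) = i mod k"
proof -
  define q r where "q = i div k" and "r = i mod k"
  have i: "i = k * q + r" "r < k" using k_pos by (simp_all add: q_def r_def)
  have "k * q < k * length w" using assms(1) window_le i length_expand[OF w(1)] by linarith
  then have q: "q < length w" by simp
  show ?thesis
  proof (cases "Suc q < length w")
    case True
    have "take m (drop i (expand w)) = take m (drop r (block (w ! q) @ block (w ! Suc q)))"
      using sublist_two_blocks[OF True, of i m] i window_le by (simp add: algebra_simps)
    then show ?thesis
      using offset_window[OF in_S in_S \<pi>_adjacent[OF True] \<open>r < k\<close>] True by (simp add: r_def)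
  next
    case False
    then have lw: "length w = Suc q" using q by simp
    then obtain q' where q': "q = Suc q'" using w(3) by (cases q) auto
    \<comment> \<open>The last block has no successor, but the window ends inside it. Any block may
      then be put after it, and that of its predecessor \<open>q'\<close> has a different
      letter.\<close>
    have "take m (drop i (expand w)) = take m (drop (k + r) (block (w ! q') @ block (w ! q)))"
      using sublist_two_blocks[of q' i m] assms i w lw q' by (simp add: algebra_simps length_expand)
    also have "\<dots> = take m (drop r (block (w ! q) @ block (w ! q')))"
      using assms i w lw q' length_block[OF in_S, of q'] length_block[OF in_S, of q]
      by (simp add: length_expand algebra_simps)
    finally show ?thesis
      using offset_window[OF in_S in_S \<pi>_adjacent[symmetric] \<open>r < k\<close>, of q'] lw q'
      by (simp add: r_def)
  qed
qed

text \<open>A square that starts at offset \<open>r\<close> of a block exposes only the tail from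
  \<open>r\<close> of the first block it meets and the head before \<open>r\<close> of the last.
  Depending on the side of \<open>cut\<close> on which \<open>r\<close> lies, one of the two is long
  enough to identify the letter.\<close>

lemma block_eq_imp_\<pi>_eq:
  assumes "q < length w" "q' < length w" "r \<le> cut \<and> drop r (block (w ! q)) = drop r (block (w ! q'))
    \<or> cut \<le> r \<and> take r (block (w ! q)) = take r (block (w ! q'))"
  shows "\<pi> (w ! q) = \<pi> (w ! q')"
proof (rule ccontr)
  assume ne: "\<pi> (w ! q) \<noteq> \<pi> (w ! q')"
  have "drop cut (block (w ! q)) = drop cut (block (w ! q'))"
    if "r \<le> cut" "drop r (block (w ! q)) = drop r (block (w ! q'))"
    using arg_cong[OF that(2), of "drop (cut - r)"] that(1) by simp
  moreover have "take cut (block (w ! q)) = take cut (block (w ! q'))"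
    if "cut \<le> r" "take r (block (w ! q)) = take r (block (w ! q'))"
    using arg_cong[OF that(2), of "take cut"] that(1) by (simp add: min_absorb1)
  ultimately show False using assms take_cut[OF in_S in_S ne] drop_cut[OF in_S in_S ne] by blast
qed

text \<open>A period of length at least \<open>m\<close> is a multiple of the block length, because both halves of the
  square show the same window. If the square starts in the middle of a block, then \<open>cut\<close> tells
  whether the letter square can be completed on the left or on the right.\<close>

lemma square_at_expand_period_less:
  assumes sq: "square_at (expand w) i p"
  shows "p < m"
proof (rule ccontr)
  assume "\<not> p < m"
  then have "m \<le> p" by simp
  have p: "0 < p" "i + 2 * p \<le> length (expand w)"
    "take p (drop i (expand w)) = take p (drop (i + p) (expand w))"
    using sq by (auto simp: square_at_iff_take_drop)
  have eq: "expand w ! x = expand w ! (x + p)" if "i \<le> x" "x < i + p" for x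
  proof -
    have "\<forall>j<p. expand w ! (i + j) = expand w ! (i + p + j)" using sq by (simp add: square_at_def)
    from this[rule_format, of "x - i"] that show ?thesis by (simp add: algebra_simps)
  qed
  have "take m (drop i (expand w)) = take m (drop (i + p) (expand w))"
    using arg_cong[OF p(3), of "take m"] \<open>m \<le> p\<close> by (simp add: min_absorb1)
  then have "i mod k = (i + p) mod k"
    using offset_expand[of i] offset_expand[of "i + p"] p \<open>m \<le> p\<close> by simp
  then have "k dvd p" by (metis add_diff_cancel_left' mod_eq_dvd_iff_nat le_add1)
  then obtain l where l: "p = k * l" by blast
  then have "0 < l" using p by (cases l) auto
  define q r where "q = i div k" and "r = i mod k"
  have i: "i = k * q + r" "r < k" using k_pos by (simp_all add: q_def r_def)
  have bound: "k * (q + 2 * l) + r \<le> k * length w"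
    using p i l w by (simp add: length_expand algebra_simps)
  then have "k * (q + 2 * l) \<le> k * length w" by linarith
  then have q2l: "q + 2 * l \<le> length w" using k_pos by simp
  \<comment> \<open>A square that starts strictly inside a block reaches into block
    \<open>q + 2 * l\<close>, which therefore exists.\<close>
  have q2l': "q + 2 * l < length w" if "0 < r"
  proof -
    have "k * (q + 2 * l) < k * length w" using bound that by linarith
    then show ?thesis by simp
  qed
  have letter: "block (w ! j) ! e = block (w ! (j + l)) ! e"
    if "e < k" "j + l < length w" "i \<le> k * j + e" "k * j + e < i + p" for j e
    using eq[OF that(3,4)] that nth_expand[of w j e] nth_expand[of w "j + l" e] w l
    by (simp add: algebra_simps)
  \<comment> \<open>Blocks strictly between \<open>q\<close> and \<open>q + l\<close> lie wholly in
    the first half of the square.\<close>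
  have full: "\<pi> (w ! j) = \<pi> (w ! (j + l))" if "q < j" "j < q + l" for j
  proof (rule block_eq_imp_\<pi>_eq[of _ _ 0])
    have "k * Suc q \<le> k * j" "k * Suc j \<le> k * (q + l)"
      using that by (intro mult_le_mono2; simp)+
    then have "block (w ! j) = block (w ! (j + l))"
      using that q2l i l length_block[OF in_S, of j] length_block[OF in_S, of "j + l"]
      by (auto simp: list_eq_iff_nth_eq algebra_simps intro!: letter)
    then show "0 \<le> cut \<and> drop 0 (block (w ! j)) = drop 0 (block (w ! (j + l))) \<or>
      cut \<le> 0 \<and> take 0 (block (w ! j)) = take 0 (block (w ! (j + l)))" by simp
  qed (use that q2l in auto)
  have "k \<le> k * l" using \<open>0 < l\<close> by simp
  show False
  proof (cases "r \<le> cut")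
    case True
    \<comment> \<open>The tail from \<open>r\<close> contains the part after \<open>cut\<close>, so
      the letter square begins at \<open>q\<close>.\<close>
    have "block (w ! q) ! (r + e) = block (w ! (q + l)) ! (r + e)" if "r + e < k" for e
      using that q2l \<open>0 < l\<close> i(1) l \<open>k \<le> k * l\<close> by (intro letter) linarith+
    then have "drop r (block (w ! q)) = drop r (block (w ! (q + l)))"
      using q2l \<open>0 < l\<close> length_block[OF in_S, of q] length_block[OF in_S, of "q + l"]
      by (simp add: list_eq_iff_nth_eq)
    with True have "\<pi> (w ! q) = \<pi> (w ! (q + l))"
      using q2l \<open>0 < l\<close> by (intro block_eq_imp_\<pi>_eq[of _ _ r]) auto
    then have "\<pi> (w ! (q + j)) = \<pi> (w ! (q + l + j))" if "j < l" for j
      using full[of "q + j"] that by (cases j) (auto simp: algebra_simps)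
    then have "square_at (map \<pi> w) q l" using q2l \<open>0 < l\<close> by (auto simp: square_at_def)
    then show False using w(2) by (simp add: square_free_def)
  next
    case False
    then have "q + 2 * l < length w" using q2l' by simp
    \<comment> \<open>Now the heads of blocks \<open>q + l\<close> and \<open>q + 2 * l\<close>
      contain the part before \<open>cut\<close>, and the letter square begins one position later,
      at \<open>Suc q\<close>.\<close>
    have "block (w ! (q + l)) ! e = block (w ! (q + l + l)) ! e" if "e < r" for e
      using that \<open>q + 2 * l < length w\<close> i l \<open>k \<le> k * l\<close> distrib_left[of k q l]
      by (intro letter) linarith+
    then have "take r (block (w ! (q + l))) = take r (block (w ! (q + l + l)))"
      using \<open>q + 2 * l < length w\<close> i(2) length_block[OF in_S, of "q + l"]
        length_block[OF in_S, of "q + l + l"]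
      by (simp add: list_eq_iff_nth_eq)
    with False have "\<pi> (w ! (q + l)) = \<pi> (w ! (q + l + l))"
      using \<open>q + 2 * l < length w\<close> by (intro block_eq_imp_\<pi>_eq[of _ _ r]) auto
    then have "\<pi> (w ! (Suc q + j)) = \<pi> (w ! (Suc q + l + j))" if "j < l" for j
      using full[of "Suc q + j"] that by (cases "Suc j = l") (auto simp: algebra_simps)
    then have "square_at (map \<pi> w) (Suc q) l"
      using \<open>q + 2 * l < length w\<close> \<open>0 < l\<close> by (auto simp: square_at_def)
    then show False using w(2) by (simp add: square_free_def)
  qed
qed

lemma square_at_expand_in_two_blocks:
  assumes sq: "square_at (expand w) i p"
  obtains a b where "a \<in> S" "b \<in> S" "\<pi> a \<noteq> \<pi> b" "p < m"
    "sublist (take (2 * p) (drop i (expand w))) (block a @ block b)"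
proof -
  have "p < m" using square_at_expand_period_less[OF sq] .
  \<comment> \<open>The cap \<open>length w - 2\<close> ensures that block \<open>Suc q\<close>
    exists even if the square starts in the last block.\<close>
  define q where "q = min (i div k) (length w - 2)"
  have q: "Suc q < length w" using w(3) by (auto simp: q_def)
  have "k * q \<le> k * (i div k)" by (rule mult_le_mono2) (simp add: q_def)
  then have "k * q \<le> i" by (rule order.trans) simp
  have "i + 2 * p \<le> k * (q + 2)"
  proof (cases "i div k \<le> length w - 2")
    case True
    have "i < k * (i div k) + k" using k_pos by (metis add_less_cancel_left mod_less_divisor mult_div_mod_eq)
    \<comment> \<open>From \<open>p\<close> \<le> \<open>m - 1\<close> follows \<open>2 * p\<close>
      \<le> \<open>k + 1\<close>, and the start is at most \<open>k - 1\<close> letters into block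
      \<open>q\<close>; the sum is at most two blocks.\<close>
    then show ?thesis using True \<open>p < m\<close> window_le by (simp add: q_def algebra_simps)
  next
    case False
    then have "q + 2 = length w" using w(3) by (simp add: q_def)
    then show ?thesis using sq w by (simp add: square_at_def length_expand)
  qed
  from sublist_two_blocks[OF q \<open>k * q \<le> i\<close> this]
  have "sublist (take (2 * p) (drop i (expand w))) (block (w ! q) @ block (w ! Suc q))"
    by (metis sublist_take sublist_drop sublist_order.order.trans)
  then show thesis using that in_S \<pi>_adjacent q \<open>p < m\<close> by (meson Suc_lessD)
qed

end

end

section \<open>Lower bound\<close>

text \<open>Looks for \<open>length ps + 1\<close> consecutive positions where both words agree. The second argument
  counts, in unary, how many further agreements the current run lacks.\<close>

fun long_match :: "unit list \<Rightarrow> unit list \<Rightarrow> 'a list \<Rightarrow> 'a list \<Rightarrow> bool" where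
  "long_match ps us (x # xs) (y # ys) \<longleftrightarrow>
     (if x = y then (case us of [] \<Rightarrow> True | _ # us' \<Rightarrow> long_match ps us' xs ys)
      else long_match ps ps xs ys)"
| "long_match ps us _ _ \<longleftrightarrow> False"

lemma long_match_here:
  "\<lbrakk>length us < length xs; length us < length ys; \<forall>j\<le>length us. xs ! j = ys ! j\<rbrakk> \<Longrightarrow>
    long_match ps us xs ys"
proof (induction ps us xs ys rule: long_match.induct)
  case (1 ps us x xs y ys)
  have "x = y" using "1.prems"(3) by (metis le0 nth_Cons_0)
  moreover have "\<forall>j\<le>length us'. xs ! j = ys ! j" if "us = u # us'" for u us'
    using "1.prems"(3) that by (metis Suc_le_mono length_Cons nth_Cons_Suc)
  ultimately show ?case using 1 by (cases us) auto
qed auto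

text \<open>A mismatch restores the full count \<open>ps\<close> and an agreement lowers it. So
  either the search succeeds before position \<open>i\<close>, or it arrives there with a count of
  at most \<open>length ps\<close>.\<close>

lemma long_match_later:
  "\<lbrakk>i + length ps < length xs; i + length ps < length ys;
    \<forall>j\<le>length ps. xs ! (i + j) = ys ! (i + j); length us \<le> length ps\<rbrakk> \<Longrightarrow>
    long_match ps us xs ys"
proof (induction ps us xs ys arbitrary: i rule: long_match.induct)
  case (1 ps us x xs y ys)
  show ?case
  proof (cases i)
    case 0
    with 1 show ?thesis by (intro long_match_here) auto
  next
    case (Suc i')
    with "1.prems" have "\<forall>j\<le>length ps. xs ! (i' + j) = ys ! (i' + j)" by auto
    with 1 Suc show ?thesis by (cases us) auto
  qed
qed auto

section \<open>Finite checks for squares, windows and cuts\<close>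

definition avoids_period :: "'a list \<Rightarrow> nat \<Rightarrow> bool" where
  "avoids_period t p \<longleftrightarrow> (let us = replicate (p - 1) () in \<not> long_match us us t (drop p t))"

lemma avoids_period_no_square:
  assumes "avoids_period t p"
  shows "\<not> square_at t i p"
proof
  assume "square_at t i p"
  \<comment> \<open>A square of period \<open>p\<close> is a run of \<open>p\<close> agreements
    between \<open>t\<close> and its shift by \<open>p\<close>; \<open>p - 1\<close> counts those
    after the first.\<close>
  then have "long_match (replicate (p - 1) ()) (replicate (p - 1) ()) t (drop p t)"
    by (intro long_match_later[of i]) (auto simp: square_at_def algebra_simps)
  with assms show False by (simp add: avoids_period_def)
qed

text \<open>A trie on the letters of a window. Leaves \<open>Offset 0\<close> also fill branches
  that no window follows; correctness rests on the check \<open>pairs_ok\<close> alone.\<close>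

datatype decode_tree = Offset nat | Branch "decode_tree list"

fun decode :: "decode_tree \<Rightarrow> nat list \<Rightarrow> nat" where
  "decode (Offset n) xs = n"
| "decode (Branch ts) [] = 0"
| "decode (Branch ts) (x # xs) = decode (ts ! x) xs"

text \<open>Executable form of the last three locale assumptions: the quantifiers range over lists,
  and the letter is the symbol modulo 3.\<close>

definition pairs_ok ::
    "nat list \<Rightarrow> (nat \<Rightarrow> nat list) \<Rightarrow> nat \<Rightarrow> nat \<Rightarrow> nat \<Rightarrow> (nat list \<Rightarrow> nat) \<Rightarrow> bool" where
  "pairs_ok as block k m cutpoint offset \<longleftrightarrow> list_all (\<lambda>a. list_all (\<lambda>b. a mod 3 \<noteq> b mod 3 \<longrightarrow>
     take cutpoint (block a) \<noteq> take cutpoint (block b) \<and> drop cutpoint (block a) \<noteq> drop cutpoint (block b) \<and>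
     (let u = block a @ block b in list_all (\<lambda>i. offset (take m (drop i u)) = i) [0..<k])) as) as"

text \<open>The images are palindromes, and those of 1 and 2 arise from that of 0 by adding 1 and 2
  modulo 3.\<close>

definition leech_block :: "nat \<Rightarrow> nat list" where
  "leech_block a = (
    if a = 0 then [0,1,2,1,0,2,1,2,0,1,2,1,0] else
    if a = 1 then [1,2,0,2,1,0,2,0,1,2,0,2,1] else
    [2,0,1,0,2,1,0,1,2,0,1,0,2])"

definition leech_offsets :: decode_tree where
  "leech_offsets =
    Branch [Branch [Offset 0, Branch [Branch [Offset 0, Offset 0, Branch [Offset 9, Branch
    [Offset 1, Offset 0, Offset 9], Offset 0]], Offset 0, Branch [Branch [Offset 0, Offset 6,
    Branch [Offset 0, Branch [Branch [Offset 0, Offset 7, Offset 12], Offset 0, Offset 7],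
    Offset 0]], Branch [Branch [Offset 0, Offset 8, Branch [Offset 8, Offset 0, Offset 0]],
    Offset 0, Offset 0], Offset 0]], Branch [Branch [Offset 0, Branch [Offset 12, Offset 0,
    Branch [Offset 5, Offset 11, Offset 0]], Offset 0], Branch [Branch [Offset 0, Branch
    [Offset 0, Offset 0, Branch [Offset 3, Offset 10, Offset 0]], Offset 2], Offset 0, Branch
    [Branch [Offset 0, Branch [Offset 10, Offset 0, Offset 4], Offset 11], Offset 0, Offset
    0]], Offset 0]], Branch [Branch [Offset 0, Branch [Offset 0, Offset 0, Branch [Branch
    [Offset 0, Offset 5, Offset 11], Offset 12, Offset 0]], Branch [Branch [Offset 0, Branch
    [Offset 11, Offset 0, Branch [Offset 4, Offset 10, Offset 0]], Offset 0], Branch [Offset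
    2, Offset 0, Branch [Branch [Offset 0, Offset 3, Offset 10], Offset 0, Offset 0]], Offset
    0]], Offset 0, Branch [Branch [Offset 0, Branch [Branch [Offset 0, Offset 0, Branch
    [Offset 7, Branch [Offset 12, Offset 0, Offset 7], Offset 0]], Offset 0, Offset 6], Branch
    [Offset 0, Branch [Branch [Offset 0, Offset 8, Offset 0], Offset 0, Offset 8], Offset 0]],
    Branch [Branch [Offset 0, Offset 9, Branch [Offset 9, Offset 1, Offset 0]], Offset 0,
    Offset 0], Offset 0]], Branch [Branch [Offset 0, Branch [Branch [Offset 0, Offset 0,
    Branch [Offset 8, Branch [Offset 0, Offset 0, Offset 8], Offset 0]], Offset 0, Branch
    [Offset 6, Branch [Branch [Offset 0, Offset 7, Branch [Offset 7, Offset 12, Offset 0]],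
    Offset 0, Offset 0], Offset 0]], Branch [Offset 0, Branch [Branch [Offset 0, Offset 9,
    Offset 1], Offset 0, Offset 9], Offset 0]], Branch [Branch [Offset 0, Branch [Offset 0,
    Offset 0, Branch [Branch [Offset 0, Offset 4, Offset 10], Offset 11, Offset 0]], Branch
    [Branch [Offset 0, Branch [Offset 10, Offset 0, Offset 3], Offset 0], Offset 2, Offset
    0]], Offset 0, Branch [Branch [Offset 0, Branch [Offset 11, Offset 0, Offset 5], Offset
    12], Offset 0, Offset 0]], Offset 0]]"

text \<open>As with \<open>square_weight\<close>, a constant of its own keeps the tree folded during
  evaluation.\<close>

definition leech_decode :: "nat list \<Rightarrow> nat" where
  "leech_decode u = decode leech_offsets u"

text \<open>The blocks differ in their first letter already, hence the cut 1.\<close>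

lemma leech_pairs_ok: "pairs_ok [0,1,2] leech_block 13 8 1 leech_decode"
  by code_simp

text \<open>The symbols \<open>0\<close> and \<open>3\<close> both stand for the letter \<open>0\<close>, hence the reduction modulo \<open>3\<close>. The blocks
  were found by computer search.\<close>

definition binary_block :: "nat \<Rightarrow> nat list" where
  "binary_block a = (
    if a = 0 then [0,0,0,1,1,1,0,0,1,0,1,1,0,0,1,1,1,0,0,0,1,0,1,1,1,0,0,1,0,1,1,0,0,0,1,1,1,0,0,1,0,1,1,1,0,0,0,1,0,1,1,0,0,1,1,1,0,0,0,1,1,0,0,1,0,1,1] else
    if a = 1 then [0,0,0,1,1,1,0,0,1,0,1,1,0,0,1,1,1,0,0,0,1,1,0,0,1,0,1,1,1,0,0,0,1,0,1,1,0,0,0,1,1,1,0,0,1,0,1,1,0,0,0,1,0,1,1,1,0,0,0,1,1,0,0,1,0,1,1] else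
    if a = 2 then [0,0,0,1,1,1,0,0,1,0,1,1,0,0,1,1,1,0,0,0,1,1,0,0,1,0,1,1,1,0,0,0,1,0,1,1,0,0,1,1,1,0,0,0,1,0,1,1,1,0,0,1,0,1,1,0,0,1,1,1,0,0,0,1,0,1,1] else
    [0,0,0,1,1,1,0,0,1,0,1,1,1,0,0,0,1,1,0,0,1,0,1,1,0,0,0,1,0,1,1,1,0,0,0,1,1,0,0,1,0,1,1,1,0,0,0,1,0,1,1,0,0,1,1,1,0,0,0,1,1,0,0,1,0,1,1])"

definition binary_offsets :: decode_tree where
  "binary_offsets =
    Branch [Branch [Branch [Branch [Offset 0, Branch [Branch [Offset 0, Branch [Offset 0,
    Branch [Branch [Branch [Branch [Offset 0, Branch [Offset 0, Branch [Offset 0, Branch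
    [Branch [Branch [Offset 0, Branch [Branch [Offset 0, Branch [Offset 0, Branch [Branch
    [Branch [Offset 29, Offset 60], Offset 0], Offset 60]]], Offset 0]], Offset 0], Offset
    0]]]], Branch [Offset 0, Branch [Offset 0, Branch [Branch [Branch [Branch [Offset 0,
    Branch [Offset 29, Offset 44]], Offset 0], Offset 0], Offset 0]]]], Offset 0], Branch
    [Branch [Branch [Branch [Offset 0, Branch [Offset 0, Branch [Branch [Branch [Offset 0,
    Branch [Branch [Offset 0, Branch [Offset 0, Branch [Offset 48, Offset 24]]], Offset 0]],
    Offset 0], Offset 0]]], Branch [Branch [Offset 0, Branch [Offset 0, Branch [Branch [Branch
    [Offset 17, Offset 41], Offset 0], Offset 0]]], Offset 0]], Offset 0], Offset 0]]]],
    Branch [Branch [Branch [Offset 0, Branch [Branch [Offset 0, Branch [Offset 0, Branch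
    [Branch [Branch [Branch [Offset 0, Branch [Offset 13, Offset 56]], Offset 0], Offset 0],
    Branch [Branch [Branch [Branch [Offset 0, Branch [Branch [Offset 0, Branch [Offset 0,
    Branch [Branch [Branch [Offset 17, Branch [Offset 0, Branch [Offset 0, Branch [Branch
    [Branch [Branch [Offset 0, Branch [Offset 17, Offset 32]], Offset 0], Offset 0], Offset
    0]]]], Offset 0], Offset 0]]], Offset 0]], Offset 0], Offset 0], Offset 0]]]], Offset 0]],
    Offset 0], Branch [Branch [Branch [Offset 0, Branch [Branch [Offset 0, Branch [Offset 0,
    Branch [Branch [Branch [Offset 36, Offset 0], Offset 0], Branch [Branch [Branch [Branch
    [Offset 0, Branch [Offset 31, Offset 0]], Offset 0], Offset 0], Offset 0]]]], Offset 0]],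
    Offset 0], Offset 0]]]], Branch [Branch [Offset 0, Branch [Offset 0, Branch [Branch
    [Branch [Branch [Offset 0, Branch [Branch [Offset 0, Branch [Offset 0, Branch [Offset 0,
    Branch [Branch [Branch [Branch [Offset 0, Branch [Offset 0, Branch [Branch [Branch [Offset
    0, Branch [Branch [Offset 0, Branch [Offset 0, Branch [Offset 42, Offset 18]]], Offset
    0]], Offset 0], Offset 0]]], Offset 0], Offset 0], Offset 0]]]], Branch [Offset 0, Branch
    [Branch [Branch [Offset 0, Branch [Branch [Offset 0, Branch [Offset 0, Branch [Branch
    [Branch [Offset 30, Offset 61], Offset 0], Branch [Branch [Branch [Branch [Offset 0,
    Branch [Offset 25, Offset 61]], Offset 0], Offset 0], Offset 0]]]], Offset 0]], Offset 0],
    Offset 0]]]], Branch [Offset 0, Branch [Offset 0, Branch [Branch [Branch [Branch [Offset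
    0, Branch [Branch [Offset 0, Branch [Offset 0, Branch [Offset 49, Branch [Branch [Branch
    [Offset 0, Branch [Branch [Offset 0, Branch [Offset 0, Branch [Branch [Branch [Offset 6,
    Offset 30], Offset 0], Offset 0]]], Offset 0]], Offset 0], Offset 0]]]], Branch [Branch
    [Branch [Offset 0, Branch [Branch [Offset 0, Branch [Offset 0, Branch [Offset 45, Offset
    6]]], Offset 0]], Offset 0], Offset 0]]], Offset 0], Offset 0], Offset 0]]]], Offset 0],
    Branch [Branch [Branch [Branch [Offset 0, Branch [Branch [Offset 0, Branch [Offset 0,
    Branch [Branch [Branch [Offset 22, Branch [Offset 0, Branch [Offset 0, Branch [Branch
    [Branch [Branch [Offset 0, Branch [Offset 22, Offset 37]], Offset 0], Offset 0], Offset
    0]]]], Offset 0], Offset 0]]], Branch [Branch [Branch [Offset 0, Branch [Branch [Offset 0,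
    Branch [Offset 0, Branch [Branch [Branch [Branch [Offset 0, Branch [Offset 6, Offset 49]],
    Offset 0], Offset 0], Offset 25]]], Offset 0]], Offset 0], Offset 0]]], Branch [Branch
    [Offset 0, Branch [Offset 0, Branch [Branch [Branch [Offset 18, Offset 42], Offset 0],
    Offset 0]]], Offset 0]], Offset 0], Offset 0]]]], Branch [Branch [Branch [Offset 0, Branch
    [Branch [Offset 0, Branch [Offset 0, Branch [Branch [Branch [Branch [Offset 0, Branch
    [Offset 14, Offset 57]], Offset 0], Offset 0], Branch [Branch [Branch [Branch [Offset 0,
    Branch [Branch [Offset 0, Branch [Offset 0, Branch [Branch [Branch [Offset 18, Branch
    [Offset 0, Branch [Offset 0, Branch [Branch [Branch [Branch [Offset 0, Branch [Offset 18,
    Offset 33]], Offset 0], Offset 0], Offset 0]]]], Offset 0], Offset 0]]], Offset 0]],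
    Offset 0], Offset 0], Offset 0]]]], Offset 0]], Offset 0], Branch [Branch [Branch [Branch
    [Offset 0, Branch [Branch [Offset 0, Branch [Offset 0, Branch [Offset 55, Branch [Branch
    [Branch [Offset 0, Branch [Branch [Offset 0, Branch [Offset 0, Branch [Branch [Branch
    [Offset 12, Offset 36], Offset 0], Offset 0]]], Offset 0]], Offset 0], Offset 0]]]],
    Branch [Branch [Branch [Offset 0, Branch [Branch [Offset 0, Branch [Offset 0, Branch
    [Offset 51, Offset 12]]], Offset 0]], Offset 0], Offset 0]]], Branch [Branch [Offset 0,
    Branch [Offset 0, Branch [Branch [Branch [Offset 37, Offset 1], Offset 0], Branch [Branch
    [Branch [Branch [Offset 0, Branch [Offset 32, Offset 1]], Offset 0], Offset 0], Offset
    0]]]], Offset 0]], Offset 0], Offset 0]]]], Branch [Branch [Offset 0, Branch [Offset 0,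
    Branch [Branch [Branch [Branch [Offset 0, Branch [Branch [Offset 0, Branch [Offset 0,
    Branch [Offset 0, Branch [Branch [Branch [Branch [Offset 0, Branch [Offset 0, Branch
    [Branch [Branch [Offset 0, Branch [Branch [Offset 0, Branch [Offset 0, Branch [Offset 43,
    Offset 19]]], Offset 0]], Offset 0], Offset 0]]], Offset 0], Offset 0], Offset 0]]]],
    Branch [Offset 0, Branch [Branch [Branch [Offset 0, Branch [Branch [Offset 0, Branch
    [Offset 0, Branch [Branch [Branch [Offset 31, Offset 62], Offset 0], Branch [Branch
    [Branch [Branch [Offset 0, Branch [Offset 26, Offset 62]], Offset 0], Offset 0], Offset
    0]]]], Offset 0]], Offset 0], Offset 0]]]], Branch [Offset 0, Branch [Offset 0, Branch
    [Branch [Branch [Branch [Offset 0, Branch [Branch [Offset 0, Branch [Offset 0, Branch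
    [Offset 50, Branch [Branch [Branch [Offset 0, Branch [Branch [Offset 0, Branch [Offset 0,
    Branch [Branch [Branch [Offset 7, Offset 31], Offset 0], Offset 0]]], Offset 0]], Offset
    0], Offset 0]]]], Branch [Branch [Branch [Offset 0, Branch [Branch [Offset 0, Branch
    [Offset 0, Branch [Offset 46, Offset 7]]], Offset 0]], Offset 0], Offset 0]]], Offset 0],
    Offset 0], Offset 0]]]], Offset 0], Branch [Branch [Branch [Branch [Offset 0, Branch
    [Branch [Offset 0, Branch [Offset 0, Branch [Branch [Branch [Offset 23, Branch [Offset 0,
    Branch [Offset 0, Branch [Branch [Branch [Branch [Offset 0, Branch [Offset 23, Offset
    38]], Offset 0], Offset 0], Offset 0]]]], Offset 0], Offset 0]]], Branch [Branch [Branch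
    [Offset 0, Branch [Branch [Offset 0, Branch [Offset 0, Branch [Branch [Branch [Branch
    [Offset 0, Branch [Offset 7, Offset 50]], Offset 0], Offset 0], Offset 26]]], Offset 0]],
    Offset 0], Offset 0]]], Branch [Branch [Offset 0, Branch [Offset 0, Branch [Branch [Branch
    [Offset 19, Offset 43], Offset 0], Offset 0]]], Offset 0]], Offset 0], Offset 0]]]],
    Branch [Branch [Branch [Branch [Offset 0, Branch [Branch [Offset 0, Branch [Offset 0,
    Branch [Offset 0, Branch [Branch [Branch [Branch [Offset 0, Branch [Offset 0, Branch
    [Branch [Branch [Offset 0, Branch [Branch [Offset 0, Branch [Offset 0, Branch [Offset 45,
    Offset 21]]], Offset 0]], Offset 0], Offset 0]]], Offset 0], Offset 0], Offset 0]]]],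
    Branch [Offset 0, Branch [Branch [Branch [Offset 0, Branch [Branch [Offset 0, Branch
    [Offset 0, Branch [Branch [Branch [Offset 33, Offset 64], Offset 0], Branch [Branch
    [Branch [Branch [Offset 0, Branch [Offset 28, Offset 64]], Offset 0], Offset 0], Offset
    0]]]], Offset 0]], Offset 0], Offset 0]]]], Branch [Branch [Offset 0, Branch [Offset 0,
    Branch [Branch [Branch [Branch [Offset 0, Branch [Offset 15, Offset 58]], Offset 0],
    Offset 0], Branch [Branch [Branch [Branch [Offset 0, Branch [Branch [Offset 0, Branch
    [Offset 0, Branch [Branch [Branch [Offset 19, Branch [Offset 0, Branch [Offset 0, Branch
    [Branch [Branch [Branch [Offset 0, Branch [Offset 19, Offset 34]], Offset 0], Offset 0],
    Offset 0]]]], Offset 0], Offset 0]]], Offset 0]], Offset 0], Offset 0], Offset 0]]]],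
    Branch [Offset 0, Branch [Branch [Branch [Branch [Offset 0, Branch [Branch [Offset 0,
    Branch [Offset 0, Branch [Offset 52, Branch [Branch [Branch [Offset 0, Branch [Branch
    [Offset 0, Branch [Offset 0, Branch [Branch [Branch [Offset 9, Offset 33], Offset 0],
    Offset 0]]], Offset 0]], Offset 0], Offset 0]]]], Branch [Branch [Branch [Offset 0, Branch
    [Branch [Offset 0, Branch [Offset 0, Branch [Offset 48, Offset 9]]], Offset 0]], Offset
    0], Offset 0]]], Offset 0], Offset 0], Offset 0]]]], Offset 0], Branch [Branch [Branch
    [Branch [Offset 0, Branch [Branch [Offset 0, Branch [Offset 0, Branch [Branch [Branch
    [Branch [Offset 0, Branch [Offset 0, Branch [Offset 0, Branch [Branch [Branch [Offset 0,
    Branch [Branch [Offset 0, Branch [Offset 0, Branch [Branch [Branch [Offset 25, Offset 56],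
    Offset 0], Offset 56]]], Offset 0]], Offset 0], Offset 0]]]], Branch [Offset 0, Branch
    [Offset 0, Branch [Branch [Branch [Branch [Offset 0, Branch [Offset 25, Offset 40]],
    Offset 0], Offset 0], Offset 0]]]], Offset 0], Branch [Branch [Branch [Offset 0, Branch
    [Branch [Offset 0, Branch [Offset 0, Branch [Branch [Branch [Offset 13, Offset 37], Offset
    0], Offset 0]]], Offset 0]], Offset 0], Offset 0]]]], Branch [Branch [Branch [Offset 0,
    Branch [Branch [Offset 0, Branch [Offset 0, Branch [Branch [Branch [Branch [Offset 0,
    Branch [Offset 9, Offset 52]], Offset 0], Offset 0], Branch [Branch [Branch [Branch
    [Offset 0, Branch [Branch [Offset 0, Branch [Offset 0, Branch [Branch [Branch [Offset 13,
    Branch [Offset 0, Branch [Offset 0, Branch [Branch [Branch [Branch [Offset 0, Branch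
    [Offset 13, Offset 28]], Offset 0], Offset 0], Offset 0]]]], Offset 0], Offset 0]]],
    Offset 0]], Offset 0], Offset 0], Offset 0]]]], Offset 0]], Offset 0], Offset 0]]], Branch
    [Branch [Offset 0, Branch [Offset 0, Branch [Branch [Branch [Branch [Offset 0, Branch
    [Offset 38, Offset 21]], Branch [Offset 0, Branch [Offset 0, Branch [Branch [Branch
    [Branch [Offset 0, Branch [Branch [Offset 0, Branch [Offset 0, Branch [Offset 45, Offset
    2]]], Offset 2]], Offset 0], Offset 0], Offset 0]]]], Offset 0], Branch [Branch [Branch
    [Branch [Offset 0, Branch [Offset 33, Offset 2]], Offset 0], Offset 0], Offset 0]]]],
    Offset 0]], Offset 0], Offset 0]]]], Branch [Branch [Branch [Branch [Offset 0, Branch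
    [Branch [Offset 0, Branch [Offset 0, Branch [Branch [Branch [Branch [Offset 0, Branch
    [Offset 0, Branch [Offset 0, Branch [Branch [Branch [Offset 0, Branch [Branch [Offset 0,
    Branch [Offset 0, Branch [Branch [Branch [Offset 28, Offset 59], Offset 0], Offset 59]]],
    Offset 0]], Offset 0], Offset 0]]]], Branch [Offset 0, Branch [Offset 0, Branch [Branch
    [Branch [Branch [Offset 0, Branch [Offset 28, Offset 43]], Offset 0], Offset 0], Offset
    0]]]], Offset 0], Branch [Branch [Branch [Branch [Offset 0, Branch [Offset 0, Branch
    [Branch [Branch [Offset 0, Branch [Branch [Offset 0, Branch [Offset 0, Branch [Offset 47,
    Offset 23]]], Offset 0]], Offset 0], Offset 0]]], Branch [Branch [Offset 0, Branch [Offset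
    0, Branch [Branch [Branch [Offset 16, Offset 40], Offset 0], Offset 0]]], Offset 0]],
    Offset 0], Offset 0]]]], Branch [Branch [Branch [Offset 0, Branch [Branch [Offset 0,
    Branch [Offset 0, Branch [Branch [Branch [Branch [Offset 0, Branch [Offset 12, Offset
    55]], Offset 0], Offset 0], Branch [Branch [Branch [Branch [Offset 0, Branch [Branch
    [Offset 0, Branch [Offset 0, Branch [Branch [Branch [Offset 16, Branch [Offset 0, Branch
    [Offset 0, Branch [Branch [Branch [Branch [Offset 0, Branch [Offset 16, Offset 31]],
    Offset 0], Offset 0], Offset 0]]]], Offset 0], Offset 0]]], Offset 0]], Offset 0], Offset
    0], Offset 0]]]], Offset 0]], Offset 0], Branch [Branch [Branch [Offset 0, Branch [Branch
    [Offset 0, Branch [Offset 0, Branch [Branch [Branch [Offset 35, Offset 66], Offset 0],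
    Branch [Branch [Branch [Branch [Offset 0, Branch [Offset 30, Offset 66]], Offset 0],
    Offset 0], Offset 0]]]], Offset 0]], Offset 0], Offset 0]]]], Branch [Branch [Offset 0,
    Branch [Offset 0, Branch [Branch [Branch [Branch [Offset 0, Branch [Branch [Offset 0,
    Branch [Offset 0, Branch [Offset 0, Branch [Branch [Branch [Branch [Offset 0, Branch
    [Offset 0, Branch [Branch [Branch [Offset 0, Branch [Branch [Offset 0, Branch [Offset 0,
    Branch [Offset 41, Offset 17]]], Offset 0]], Offset 0], Offset 0]]], Offset 0], Offset 0],
    Offset 0]]]], Branch [Offset 0, Branch [Branch [Branch [Offset 0, Branch [Branch [Offset
    0, Branch [Offset 0, Branch [Offset 60, Branch [Branch [Branch [Branch [Offset 0, Branch
    [Offset 24, Offset 60]], Offset 0], Offset 0], Offset 0]]]], Offset 0]], Offset 0], Offset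
    0]]]], Branch [Offset 0, Branch [Offset 0, Branch [Branch [Branch [Branch [Offset 0,
    Branch [Branch [Offset 0, Branch [Offset 0, Branch [Offset 48, Offset 5]]], Offset 5]],
    Offset 0], Offset 0], Offset 0]]]], Offset 0], Branch [Branch [Branch [Branch [Offset 0,
    Branch [Branch [Offset 0, Branch [Offset 0, Branch [Branch [Branch [Offset 21, Branch
    [Offset 0, Branch [Offset 0, Branch [Branch [Branch [Branch [Offset 0, Branch [Offset 21,
    Offset 36]], Offset 0], Offset 0], Offset 0]]]], Offset 0], Offset 0]]], Offset 5]],
    Offset 0], Offset 0], Offset 0]]]], Branch [Offset 0, Branch [Branch [Branch [Branch
    [Offset 0, Branch [Branch [Offset 0, Branch [Offset 0, Branch [Offset 54, Branch [Branch
    [Branch [Offset 0, Branch [Branch [Offset 0, Branch [Offset 0, Branch [Branch [Branch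
    [Offset 11, Offset 35], Offset 0], Offset 0]]], Offset 0]], Offset 0], Offset 0]]]],
    Branch [Branch [Branch [Offset 0, Branch [Branch [Offset 0, Branch [Offset 0, Branch
    [Offset 50, Offset 11]]], Offset 0]], Offset 0], Offset 0]]], Offset 0], Offset 0], Offset
    0]]]], Branch [Offset 0, Branch [Branch [Branch [Branch [Offset 0, Branch [Branch [Offset
    0, Branch [Offset 0, Branch [Offset 0, Branch [Branch [Branch [Branch [Offset 0, Branch
    [Offset 0, Branch [Branch [Branch [Offset 0, Branch [Branch [Offset 0, Branch [Offset 0,
    Branch [Offset 44, Offset 20]]], Offset 0]], Offset 0], Offset 0]]], Offset 0], Offset 0],
    Offset 0]]]], Branch [Offset 0, Branch [Branch [Branch [Offset 0, Branch [Branch [Offset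
    0, Branch [Offset 0, Branch [Branch [Branch [Offset 32, Offset 63], Offset 0], Branch
    [Branch [Branch [Branch [Offset 0, Branch [Offset 27, Offset 63]], Offset 0], Offset 0],
    Offset 0]]]], Offset 0]], Offset 0], Offset 0]]]], Branch [Offset 0, Branch [Offset 0,
    Branch [Branch [Branch [Branch [Offset 0, Branch [Branch [Offset 0, Branch [Offset 0,
    Branch [Offset 51, Branch [Branch [Branch [Offset 0, Branch [Branch [Offset 0, Branch
    [Offset 0, Branch [Branch [Branch [Offset 8, Offset 32], Offset 0], Offset 0]]], Offset
    0]], Offset 0], Offset 0]]]], Branch [Branch [Branch [Offset 0, Branch [Branch [Offset 0,
    Branch [Offset 0, Branch [Offset 47, Offset 8]]], Offset 0]], Offset 0], Offset 0]]],
    Offset 0], Offset 0], Offset 0]]]], Offset 0], Branch [Branch [Branch [Branch [Offset 0,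
    Branch [Branch [Offset 0, Branch [Offset 0, Branch [Branch [Branch [Offset 24, Branch
    [Offset 0, Branch [Offset 0, Branch [Branch [Branch [Branch [Offset 0, Branch [Offset 24,
    Offset 39]], Offset 0], Offset 0], Offset 0]]]], Offset 0], Offset 0]]], Branch [Branch
    [Branch [Offset 0, Branch [Branch [Offset 0, Branch [Offset 0, Branch [Branch [Branch
    [Branch [Offset 0, Branch [Offset 8, Offset 51]], Offset 0], Offset 0], Offset 27]]],
    Offset 0]], Offset 0], Offset 0]]], Branch [Branch [Offset 0, Branch [Offset 0, Branch
    [Branch [Branch [Offset 20, Offset 44], Offset 0], Offset 0]]], Offset 0]], Offset 0],
    Offset 0]]]], Branch [Branch [Branch [Branch [Offset 0, Branch [Branch [Offset 0, Branch
    [Offset 0, Branch [Branch [Branch [Branch [Offset 0, Branch [Offset 0, Branch [Offset 0,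
    Branch [Branch [Branch [Offset 0, Branch [Branch [Offset 0, Branch [Offset 0, Branch
    [Branch [Branch [Offset 27, Offset 58], Offset 0], Offset 58]]], Offset 0]], Offset 0],
    Offset 0]]]], Branch [Offset 0, Branch [Offset 0, Branch [Branch [Branch [Branch [Offset
    0, Branch [Offset 27, Offset 42]], Offset 0], Offset 0], Offset 0]]]], Offset 0], Branch
    [Branch [Branch [Branch [Offset 0, Branch [Offset 0, Branch [Branch [Branch [Offset 0,
    Branch [Branch [Offset 0, Branch [Offset 0, Branch [Offset 46, Offset 22]]], Offset 0]],
    Offset 0], Offset 0]]], Branch [Branch [Offset 0, Branch [Offset 0, Branch [Branch [Branch
    [Offset 15, Offset 39], Offset 0], Offset 0]]], Offset 0]], Offset 0], Offset 0]]]],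
    Branch [Branch [Branch [Offset 0, Branch [Branch [Offset 0, Branch [Offset 0, Branch
    [Branch [Branch [Branch [Offset 0, Branch [Offset 11, Offset 54]], Offset 0], Offset 0],
    Branch [Branch [Branch [Branch [Offset 0, Branch [Branch [Offset 0, Branch [Offset 0,
    Branch [Branch [Branch [Offset 15, Branch [Offset 0, Branch [Offset 0, Branch [Branch
    [Branch [Branch [Offset 0, Branch [Offset 15, Offset 30]], Offset 0], Offset 0], Offset
    0]]]], Offset 0], Offset 0]]], Offset 0]], Offset 0], Offset 0], Offset 0]]]], Offset 0]],
    Offset 0], Branch [Branch [Branch [Offset 0, Branch [Branch [Offset 0, Branch [Offset 0,
    Branch [Branch [Branch [Offset 34, Offset 65], Offset 0], Branch [Branch [Branch [Branch
    [Offset 0, Branch [Offset 29, Offset 65]], Offset 0], Offset 0], Offset 0]]]], Offset 0]],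
    Offset 0], Offset 0]]]], Branch [Branch [Offset 0, Branch [Offset 0, Branch [Branch
    [Branch [Branch [Offset 0, Branch [Branch [Offset 0, Branch [Offset 0, Branch [Offset 0,
    Branch [Branch [Branch [Branch [Offset 0, Branch [Offset 0, Branch [Branch [Branch [Offset
    0, Branch [Branch [Offset 0, Branch [Offset 0, Branch [Offset 40, Offset 16]]], Offset
    0]], Offset 0], Offset 0]]], Offset 0], Offset 0], Offset 0]]]], Branch [Offset 0, Branch
    [Branch [Branch [Offset 0, Branch [Branch [Offset 0, Branch [Offset 0, Branch [Offset 59,
    Branch [Branch [Branch [Branch [Offset 0, Branch [Offset 23, Offset 59]], Offset 0],
    Offset 0], Offset 0]]]], Offset 0]], Offset 0], Offset 0]]]], Branch [Offset 0, Branch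
    [Offset 0, Branch [Branch [Branch [Branch [Offset 0, Branch [Branch [Offset 0, Branch
    [Offset 0, Branch [Offset 47, Offset 4]]], Offset 4]], Offset 0], Offset 0], Offset 0]]]],
    Offset 0], Branch [Branch [Branch [Branch [Offset 0, Branch [Branch [Offset 0, Branch
    [Offset 0, Branch [Branch [Branch [Offset 20, Branch [Offset 0, Branch [Offset 0, Branch
    [Branch [Branch [Branch [Offset 0, Branch [Offset 20, Offset 35]], Offset 0], Offset 0],
    Offset 0]]]], Offset 0], Offset 0]]], Offset 4]], Offset 0], Offset 0], Offset 0]]]],
    Branch [Offset 0, Branch [Branch [Branch [Branch [Offset 0, Branch [Branch [Offset 0,
    Branch [Offset 0, Branch [Offset 53, Branch [Branch [Branch [Offset 0, Branch [Branch
    [Offset 0, Branch [Offset 0, Branch [Branch [Branch [Offset 10, Offset 34], Offset 0],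
    Offset 0]]], Offset 0]], Offset 0], Offset 0]]]], Branch [Branch [Branch [Offset 0, Branch
    [Branch [Offset 0, Branch [Offset 0, Branch [Offset 49, Offset 10]]], Offset 0]], Offset
    0], Offset 0]]], Offset 0], Offset 0], Offset 0]]]], Offset 0], Branch [Branch [Branch
    [Branch [Offset 0, Branch [Branch [Offset 0, Branch [Offset 0, Branch [Branch [Branch
    [Branch [Offset 0, Branch [Offset 0, Branch [Offset 0, Branch [Branch [Branch [Offset 0,
    Branch [Branch [Offset 0, Branch [Offset 0, Branch [Branch [Branch [Offset 26, Offset 57],
    Offset 0], Offset 57]]], Offset 0]], Offset 0], Offset 0]]]], Branch [Offset 0, Branch
    [Offset 0, Branch [Branch [Branch [Branch [Offset 0, Branch [Offset 26, Offset 41]],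
    Offset 0], Offset 0], Offset 0]]]], Offset 0], Branch [Branch [Branch [Offset 0, Branch
    [Branch [Offset 0, Branch [Offset 0, Branch [Branch [Branch [Offset 14, Offset 38], Offset
    0], Offset 0]]], Offset 0]], Offset 0], Offset 0]]]], Branch [Branch [Branch [Offset 0,
    Branch [Branch [Offset 0, Branch [Offset 0, Branch [Branch [Branch [Branch [Offset 0,
    Branch [Offset 10, Offset 53]], Offset 0], Offset 0], Branch [Branch [Branch [Branch
    [Offset 0, Branch [Branch [Offset 0, Branch [Offset 0, Branch [Branch [Branch [Offset 14,
    Branch [Offset 0, Branch [Offset 0, Branch [Branch [Branch [Branch [Offset 0, Branch
    [Offset 14, Offset 29]], Offset 0], Offset 0], Offset 0]]]], Offset 0], Offset 0]]],
    Offset 0]], Offset 0], Offset 0], Offset 0]]]], Offset 0]], Offset 0], Offset 0]]], Branch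
    [Branch [Offset 0, Branch [Offset 0, Branch [Branch [Branch [Branch [Offset 0, Branch
    [Offset 39, Offset 22]], Branch [Offset 0, Branch [Offset 0, Branch [Branch [Branch
    [Branch [Offset 0, Branch [Branch [Offset 0, Branch [Offset 0, Branch [Offset 46, Offset
    3]]], Offset 3]], Offset 0], Offset 0], Offset 0]]]], Offset 0], Branch [Branch [Branch
    [Branch [Offset 0, Branch [Offset 34, Offset 3]], Offset 0], Offset 0], Offset 0]]]],
    Offset 0]], Offset 0], Offset 0]]]]"

definition binary_decode :: "nat list \<Rightarrow> nat" where
  "binary_decode u = decode binary_offsets u"

text \<open>The images of 1 and 2 share their first 38 letters, so 39 is the least possible
  cut.\<close>

lemma binary_pairs_ok: "pairs_ok [0,1,2,3] binary_block 67 35 39 binary_decode"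
  by code_simp

text \<open>Synchronization leaves open exactly the periods below the window length 8.\<close>

lemma leech_squares:
  "list_all (\<lambda>a. list_all (\<lambda>b. a \<noteq> b \<longrightarrow>
     list_all (avoids_period (leech_block a @ leech_block b)) [1..<8]) [0,1,2]) [0,1,2]"
  by code_simp

text \<open>Of the binary squares of period 1 or 2, only the three listed words are forbidden.
  Squares of period 3 up to 34, below the window length 35, must not occur at all.\<close>

lemma binary_squares:
  "list_all (\<lambda>a. list_all (\<lambda>b. a mod 3 \<noteq> b mod 3 \<longrightarrow>
     (let u = binary_block a @ binary_block b in
       list_all (\<lambda>s. \<not> sublist s u) [[0,0,0,0], [1,1,1,1], [1,0,1,0]] \<and>
       list_all (avoids_period u) [3..<35])) [0,1,2,3]) [0,1,2,3]"
  by code_simp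

section \<open>From the finite checks to the two substitutions\<close>

lemma synchronizing_blocks_of_pairs_ok:
  assumes "pairs_ok as block k m cutpoint offset" "\<And>a. a \<in> set as \<Longrightarrow> length (block a) = k"
    "0 < m" "m \<le> k" "2 * m \<le> k + 3"
  shows "synchronizing_blocks (set as) block (\<lambda>a. a mod 3) k m cutpoint offset"
  using assms by unfold_locales (auto simp: pairs_ok_def list_all_iff Let_def)

lemma square_at_take_drop:
  assumes "square_at t i p" "sublist (take (2 * p) (drop i t)) u"
  obtains i' where "square_at u i' p"
proof -
  let ?x = "take p (drop i t)"
  have "take (2 * p) (drop i t) = ?x @ take p (drop (i + p) t)"
    by (simp add: mult_2 take_add add.commute)
  then have "take (2 * p) (drop i t) = ?x @ ?x" using assms(1) by (simp add: square_at_iff_take_drop)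
  then obtain ys zs where "u = ys @ (?x @ ?x) @ zs" using assms(2) by (metis sublist_def)
  moreover have "length ?x = p" "?x \<noteq> []" using assms(1) by (auto simp: square_at_def)
  ultimately show thesis using square_at_append[of ?x ys zs] that by metis
qed

text \<open>Both interpretations meet \<open>2 * m\<close> \<le> \<open>k + 3\<close> with equality:
  16 = 13 + 3 and 70 = 67 + 3.\<close>

interpretation leech: synchronizing_blocks "set [0,1,2]" leech_block "\<lambda>a. a mod 3" 13 8 1 leech_decode
  by (rule synchronizing_blocks_of_pairs_ok[OF leech_pairs_ok]) (auto simp: leech_block_def)

interpretation binary: synchronizing_blocks "set [0,1,2,3]" binary_block "\<lambda>a. a mod 3" 67 35 39
    binary_decode
  by (rule synchronizing_blocks_of_pairs_ok[OF binary_pairs_ok]) (auto simp: binary_block_def)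

lemma square_free_leech:
  assumes "set w \<subseteq> {0,1,2}" "square_free w" "2 \<le> length w"
  shows "square_free (leech.expand w)"
  unfolding square_free_def
proof (intro allI notI)
  fix i p assume sq: "square_at (leech.expand w) i p"
  \<comment> \<open>Each letter is its own only symbol here, so square-freeness modulo 3 is
    square-freeness of \<open>w\<close>.\<close>
  have "map (\<lambda>a. a mod 3) w = w" using assms(1) by (intro map_idI) auto
  with assms sq obtain a b where ab: "a \<in> set [0,1,2]" "b \<in> set [0,1,2]" "a mod 3 \<noteq> b mod 3" "p < 8"
    "sublist (take (2 * p) (drop i (leech.expand w))) (leech_block a @ leech_block b)"
    using leech.square_at_expand_in_two_blocks[of w i p] by (metis list.simps(15) empty_set)
  then obtain i' where sq': "square_at (leech_block a @ leech_block b) i' p"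
    using square_at_take_drop[OF sq] by blast
  have "p \<in> set [1..<8]" using sq ab by (auto simp: square_at_def)
  then have "avoids_period (leech_block a @ leech_block b) p"
    using leech_squares ab by (fastforce simp: list_all_iff)
  then show False using sq' avoids_period_no_square by blast
qed

lemma leech_expand_ternary: "set (leech.expand w) \<subseteq> {0,1,2}"
  by (auto simp: leech.expand_def leech_block_def split: if_splits)

section \<open>Long square-free ternary words with many letters 0\<close>

lemma square_free_take:
  assumes "square_free w"
  shows "square_free (take n w)"
proof -
  have "square_at w i p" if "square_at (take n w) i p" for i p
    using that by (auto simp: square_at_def)
  with assms show ?thesis by (auto simp: square_free_def)
qed

text \<open>Iterating the morphism from \<open>[0,1]\<close> multiplies the length by 13 each time.
  The summand 2 supplies the length condition of \<open>square_free_leech\<close>.\<close>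

lemma ex_long_ternary_square_free:
  "\<exists>w. set w \<subseteq> {0,1,2 :: nat} \<and> square_free w \<and> n + 2 \<le> length w"
proof (induction n)
  case 0
  have "\<not> square_at [0, 1 :: nat] i p" for i p
  proof
    assume sq: "square_at [0, 1 :: nat] i p"
    then have "0 < p" "i + 2 * p \<le> 2" by (auto simp: square_at_def)
    then have "i = 0" "p = 1" by linarith+
    with sq show False by (simp add: square_at_iff_take_drop)
  qed
  then have "square_free [0, 1 :: nat]" by (simp add: square_free_def)
  then show ?case by (intro exI[of _ "[0,1]"]) simp
next
  case (Suc n)
  then obtain w where w: "set w \<subseteq> {0,1,2 :: nat}" "square_free w" "n + 2 \<le> length w" by blast
  then have "square_free (leech.expand w)" "length (leech.expand w) = 13 * length w"
    using square_free_leech leech.length_expand by auto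
  then show ?case using w(3) leech_expand_ternary by (intro exI[of _ "leech.expand w"]) auto
qed

lemma count_leech_expand: "length w \<le> count_list (leech.expand w) 0"
proof (induction w)
  case (Cons a w)
  have "1 \<le> count_list (leech_block a) 0" by (simp add: leech_block_def)
  with Cons show ?case by (simp add: leech.expand_Cons)
qed simp

text \<open>Truncating before the last application of the morphism gives the exact length and keeps
  all blocks whole, each with a letter 0.\<close>

lemma ex_ternary_square_free_count:
  assumes "2 \<le> n"
  obtains w where "set w \<subseteq> {0,1,2 :: nat}" "square_free w" "length w = 13 * n" "n \<le> count_list w 0"
proof -
  obtain w where w: "set w \<subseteq> {0,1,2 :: nat}" "square_free w" "n + 2 \<le> length w"
    using ex_long_ternary_square_free by blast
  define v where "v = take n w"
  have v: "set v \<subseteq> {0,1,2}" "square_free v" "length v = n"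
    using w set_take_subset[of n w] by (auto simp: v_def square_free_take)
  show thesis
  proof (rule that)
    show "square_free (leech.expand v)" using square_free_leech v assms by simp
    show "length (leech.expand v) = 13 * n" using leech.length_expand[of v] v by simp
    show "n \<le> count_list (leech.expand v) 0" using count_leech_expand[of v] v by simp
  qed (rule leech_expand_ternary)
qed

text \<open>The four blocks are distinct and equally long, so images can be compared block by block.
  Different choices of symbols thus give different binary words.\<close>

lemma binary_expand_injective:
  assumes "length u = length v" "set u \<subseteq> {0,1,2,3}" "set v \<subseteq> {0,1,2,3}"
    "binary.expand u = binary.expand v"
  shows "u = v"
  using assms
proof (induction u v rule: list_induct2)
  case (Cons a u b v)
  have "length (binary_block a) = length (binary_block b)"
    using Cons.prems binary.length_block[of a] binary.length_block[of b] by auto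
  then have "binary_block a = binary_block b" "binary.expand u = binary.expand v"
    using Cons.prems by (auto simp: binary.expand_Cons)
  moreover from this(1) have "a = b"
    using Cons.prems by (auto simp: binary_block_def split: if_splits)
  ultimately show ?case using Cons by simp
qed simp

text \<open>Synchronization puts every square, with period below 35, into the image of two distinct
  letters. The finite check leaves periods 1 and 2 there, and among those only the allowed
  squares.\<close>

lemma good_binary_expand:
  assumes "set u \<subseteq> {0,1,2,3}" "square_free (map (\<lambda>a. a mod 3) u)" "2 \<le> length u"
  shows "good (binary.expand u)"
  unfolding good_def
proof (intro conjI allI impI)
  show bin: "binary_word (binary.expand u)"
    by (auto simp: binary_word_def binary.expand_def binary_block_def split: if_splits)
  fix s assume "sublist s (binary.expand u) \<and> is_square s"
  then obtain x ys zs where x: "x \<noteq> []" "s = x @ x" "binary.expand u = ys @ (x @ x) @ zs"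
    by (auto simp: is_square_def sublist_def)
  define p where "p = length x"
  have sq: "square_at (binary.expand u) (length ys) p"
    unfolding x(3) p_def by (rule square_at_append) fact
  have s_eq: "take (2 * p) (drop (length ys) (binary.expand u)) = s"
    unfolding x(3) p_def x(2) by simp
  obtain a b where ab: "a \<in> set [0,1,2,3]" "b \<in> set [0,1,2,3]" "a mod 3 \<noteq> b mod 3" "p < 35"
    and sub: "sublist s (binary_block a @ binary_block b)"
    using binary.square_at_expand_in_two_blocks[OF _ assms(2,3) sq] assms(1) unfolding s_eq by auto
  have ok: "\<forall>s\<in>set [[0,0,0,0],[1,1,1,1],[1,0,1,0]]. \<not> sublist s (binary_block a @ binary_block b)"
    "\<forall>p\<in>set [3..<35]. avoids_period (binary_block a @ binary_block b) p"
    using binary_squares ab unfolding list_all_iff Let_def by blast+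
  obtain i' where "square_at (binary_block a @ binary_block b) i' p"
    using square_at_take_drop[OF sq] sub unfolding s_eq by blast
  then have "p \<notin> set [3..<35]" using ok(2) avoids_period_no_square by blast
  moreover have "0 < p" using x(1) by (simp add: p_def)
  ultimately have "p = 1 \<or> p = 2" using \<open>p < 35\<close> unfolding set_upt atLeastLessThan_iff by linarith
  moreover have "set x \<subseteq> {0, 1}" using bin unfolding binary_word_def x(3) by simp
  ultimately show "s \<in> allowed_squares"
  proof (elim disjE)
    assume "p = 1"
    then obtain c where "x = [c]" by (auto simp: p_def length_Suc_conv)
    then show ?thesis using \<open>set x \<subseteq> {0, 1}\<close> x(2) by (auto simp: allowed_squares_def)
  next
    assume "p = 2"
    then obtain c d where "x = [c, d]" by (auto simp: p_def numeral_2_eq_2 length_Suc_conv)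
    then show ?thesis using \<open>set x \<subseteq> {0, 1}\<close> x(2) ok(1) sub by (auto simp: allowed_squares_def)
  qed
qed

section \<open>Counting the lifts of a ternary word\<close>

definition preimages :: "nat list \<Rightarrow> nat list set" where
  "preimages w = {u. set u \<subseteq> {0,1,2,3} \<and> map (\<lambda>a. a mod 3) u = w}"

lemma finite_preimages: "finite (preimages w)"
proof (rule finite_subset)
  show "preimages w \<subseteq> {u. set u \<subseteq> {0,1,2,3} \<and> length u = length w}"
    by (auto simp: preimages_def)
qed (rule finite_lists_length_eq, simp)

text \<open>Each letter 0 lifts independently to the symbol 0 or 3.\<close>

lemma card_preimages: "set w \<subseteq> {0,1,2} \<Longrightarrow> 2 ^ count_list w 0 \<le> card (preimages w)"
proof (induction w)
  case Nil
  have "preimages [] = {[]}" by (auto simp: preimages_def)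
  then show ?case by simp
next
  case (Cons c w)
  have sub: "(#) c ` preimages w \<subseteq> preimages (c # w)"
    using Cons.prems by (auto simp: preimages_def)
  show ?case
  proof (cases "c = 0")
    case False
    have "card (preimages w) = card ((#) c ` preimages w)" by (simp add: card_image)
    also have "\<dots> \<le> card (preimages (c # w))" using sub finite_preimages by (rule card_mono[rotated])
    finally show ?thesis using Cons False by simp
  next
    case True
    have "2 * card (preimages w) = card ((#) 0 ` preimages w) + card ((#) 3 ` preimages w)"
      by (simp add: card_image)
    also have "\<dots> = card ((#) 0 ` preimages w \<union> (#) 3 ` preimages w)"
      by (subst card_Un_disjoint) (auto simp: finite_preimages)
    also have "\<dots> \<le> card (preimages (c # w))"
      using sub True by (intro card_mono finite_preimages) (auto simp: preimages_def)
    finally show ?thesis using Cons True by simp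
  qed
qed

lemma H_multiple_ge:
  assumes "2 \<le> n"
  shows "2 ^ n \<le> H (871 * n)"
proof -
  obtain w where w: "set w \<subseteq> {0,1,2 :: nat}" "square_free w" "length w = 13 * n" "n \<le> count_list w 0"
    using ex_ternary_square_free_count[OF assms] .
  have "(2 :: nat) ^ n \<le> 2 ^ count_list w 0" using w by (intro power_increasing) auto
  also have "\<dots> \<le> card (preimages w)" using w by (intro card_preimages)
  also have "\<dots> = card (binary.expand ` preimages w)"
  proof (rule card_image[symmetric], rule inj_onI)
    fix u v assume uv: "u \<in> preimages w" "v \<in> preimages w" "binary.expand u = binary.expand v"
    have "length x = length w" if "x \<in> preimages w" for x
      using that by (auto simp: preimages_def)
    with uv have "length u = length v" by metis
    then show "u = v" by (rule binary_expand_injective) (use uv in \<open>auto simp: preimages_def\<close>)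
  qed
  also have "\<dots> \<le> card (extensions [] (871 * n))"
  proof (rule card_mono[OF finite_extensions], rule image_subsetI)
    fix u assume "u \<in> preimages w"
    then have u: "set u \<subseteq> {0,1,2,3}" "map (\<lambda>a. a mod 3) u = w" by (auto simp: preimages_def)
    then have "length u = 13 * n" using w by auto
    then show "binary.expand u \<in> extensions [] (871 * n)"
      using good_binary_expand[of u] binary.length_expand[of u] u w assms by (simp add: extensions_def)
  qed
  finally show ?thesis by (simp add: H_eq_card_extensions)
qed

section \<open>Passage to all lengths and the growth rates\<close>

lemma H_add_le: "H (n + j) \<le> 2 ^ j * H n"
proof (induction j)
  case (Suc j)
  then show ?case using H_Suc_le[of "n + j"] by simp
qed simp

lemma power_1_0006_le: "(1.0006 :: real) ^ 871 \<le> 2"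
proof -
  have "(1.0006 :: real) ^ 871 \<le> exp 0.0006 ^ 871"
    using exp_ge_add_one_self[of "0.0006 :: real"] by (intro power_mono) auto
  also have "\<dots> = exp (871 * 0.0006)" by (simp add: exp_of_nat_mult[symmetric])
  \<comment> \<open>The exponent is 0.5226, within the range [0, 1] of \<open>exp_bound\<close>; the
    right side is about 1.796.\<close>
  also have "\<dots> \<le> 1 + 871 * 0.0006 + (871 * 0.0006)\<^sup>2" by (rule exp_bound) simp_all
  also have "\<dots> \<le> (2 :: real)" by (simp add: power2_eq_square)
  finally show ?thesis .
qed

lemma H_lower: "(1.0006 :: real) ^ n \<le> 2 ^ 1742 * real (H n)"
proof -
  \<comment> \<open>The summand 2 gives \<open>q\<close> \<ge> 2, as \<open>H_multiple_ge\<close>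
    requires, and \<open>871 * q\<close> exceeds \<open>n\<close> by at most 1742 = 2 * 871.\<close>
  define q where "q = n div 871 + 2"
  have n: "n \<le> 871 * q" "871 * q - n \<le> 1742"
    using mult_div_mod_eq[of 871 n] mod_less_divisor[of 871 n] by (auto simp: q_def)
  have "(1.0006 :: real) ^ n \<le> 1.0006 ^ (871 * q)" using n by (intro power_increasing) auto
  also have "\<dots> = (1.0006 ^ 871) ^ q" by (simp add: power_mult)
  also have "\<dots> \<le> 2 ^ q" using power_1_0006_le by (intro power_mono) auto
  also have "\<dots> \<le> real (H (871 * q))"
  proof -
    have "2 ^ q \<le> H (871 * q)" by (rule H_multiple_ge) (simp add: q_def)
    then show ?thesis by (metis of_nat_le_iff of_nat_numeral of_nat_power)
  qed
  also have "\<dots> \<le> real (2 ^ 1742 * H n)"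
  proof -
    have "H (871 * q) \<le> 2 ^ (871 * q - n) * H n" using H_add_le[of n "871 * q - n"] n by simp
    also have "\<dots> \<le> 2 ^ 1742 * H n" using n by (intro mult_right_mono power_increasing) auto
    finally show ?thesis by (simp only: of_nat_le_iff)
  qed
  finally show ?thesis by (simp only: of_nat_mult of_nat_power of_nat_numeral)
qed

theorem theorem12:
  "(\<lambda>n. real (H n)) \<in> \<Omega>(\<lambda>n. (1.0006 :: real) ^ n) \<and>
   (\<lambda>n. real (H n)) \<in> O(\<lambda>n. (1.135 :: real) ^ n)"
proof
  show "(\<lambda>n. real (H n)) \<in> \<Omega>(\<lambda>n. (1.0006 :: real) ^ n)"
  proof -
    obtain C where "(1.0006 :: real) ^ n \<le> C * real (H n)" for n using H_lower by blast
    then have "(\<lambda>n. (1.0006 :: real) ^ n) \<in> O(\<lambda>n. real (H n))"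
      by (intro bigoI[of _ C] always_eventually allI) simp
    then show ?thesis by (simp only: bigomega_iff_bigo)
  qed
  show "(\<lambda>n. real (H n)) \<in> O(\<lambda>n. (1.135 :: real) ^ n)"
    using H_upper by (intro bigoI[of _ "of_int (weight square_contexts [])"]) simp
qed

end
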